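(* Let $X$ be a Banach space with micro-transitive norm. Then there is a function $\beta:(0,2)\to(0,\infty)$ such that whenever $\varepsilon\in(0,2)$ and $x,y\in S_X$ satisfy $\|x-y\|<\beta(\varepsilon)$, there is a surjective linear isometry $T\in\mathcal{L}(X)$ satisfying $Tx=y$ and $\|T-\mathrm{Id}\|<\varepsilon$.
   Context: Banach spaces are over $\mathbb{K}=\mathbb{R}$ or $\mathbb{C}$. $S_X$ is the unit sphere of $X$, $\mathcal{L}(X)$ the space of bounded linear operators on $X$ with the operator norm, and $\mathrm{Id}$ the identity operator. The norm of $X$ is micro-transitive if the group $G$ of surjective linear isometries of $X$ (with the operator-norm topology) acts micro-transitively on $S_X$: for every $x\in S_X$ and every neighborhood $U$ of $\mathrm{Id}$ in $G$, the set $Ux=\{Tx : T\in U\}$ is a neighborhood of $x$ in $S_X$. *)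

theory Defs
  imports "HOL-Analysis.Analysis"
begin

text \<open>
  The scalar field is a type of class \<open>real_normed_field\<close>. The types \<open>real\<close> and \<open>complex\<close> are
  instances, and by the Gelfand--Mazur theorem every instance is isometrically isomorphic,
  as a real algebra, to one of them. The class \<open>banach\<close> of the vectors only provides
  the underlying real Banach space, so scalar multiplication by the field is an explicit
  operation \<open>scl\<close> that extends the real one.
\<close>

locale banach_space_over = vector_space scl
  for scl :: "'k::real_normed_field \<Rightarrow> 'a::banach \<Rightarrow> 'a" +
  assumes norm_scale: "norm (scl c x) = norm c * norm x"
    and scale_of_real: "scl (of_real r) x = r *\<^sub>R x"

lemma banach_space_over_real:
  "banach_space_over (scaleR :: real \<Rightarrow> 'a::banach \<Rightarrow> 'a)"
  by unfold_locales (auto simp: algebra_simps)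

lemma banach_space_over_complex:
  "banach_space_over ((*) :: complex \<Rightarrow> complex \<Rightarrow> complex)"
  by unfold_locales (auto simp: algebra_simps norm_mult scaleR_conv_of_real)

text \<open>
  The elements of \<open>'a \<Rightarrow>\<^sub>L 'a\<close> are the bounded real-linear operators; those that
  are linear over the scalar field form a subspace, on which the norm of \<open>'a \<Rightarrow>\<^sub>L 'a\<close> is the
  operator norm.
\<close>

definition bounded_operators ::
    "('k::real_normed_field \<Rightarrow> 'a::banach \<Rightarrow> 'a) \<Rightarrow> ('a \<Rightarrow>\<^sub>L 'a) set" where
  "bounded_operators scl = {T. Vector_Spaces.linear scl scl (blinfun_apply T)}"

definition surjective_isometries ::
    "('k::real_normed_field \<Rightarrow> 'a::banach \<Rightarrow> 'a) \<Rightarrow> ('a \<Rightarrow>\<^sub>L 'a) set" where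
  "surjective_isometries scl =
     {T \<in> bounded_operators scl. surj (blinfun_apply T) \<and> (\<forall>x. norm (blinfun_apply T x) = norm x)}"

text \<open>A neighbourhood need not be open.\<close>

definition neighbourhood_in :: "'b topology \<Rightarrow> 'b \<Rightarrow> 'b set \<Rightarrow> bool" where
  "neighbourhood_in X a N \<longleftrightarrow> N \<subseteq> topspace X \<and> (\<exists>V. openin X V \<and> a \<in> V \<and> V \<subseteq> N)"

definition micro_transitive_norm ::
    "('k::real_normed_field \<Rightarrow> 'a::banach \<Rightarrow> 'a) \<Rightarrow> bool" where
  "micro_transitive_norm scl \<longleftrightarrow>
     (\<forall>x \<in> sphere 0 1. \<forall>U.
        neighbourhood_in (top_of_set (surjective_isometries scl)) id_blinfun U \<longrightarrow>
        neighbourhood_in (top_of_set (sphere 0 1)) x ((\<lambda>T. blinfun_apply T x) ` U))"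

end

theory Submission imports Defs begin

text \<open>
  The isometry group acts transitively on the unit sphere: its orbits are open by
  micro-transitivity, the normalised segment joins any \<open>x\<close> to any \<open>y \<noteq> - x\<close>
  inside the sphere, and \<open>- Id\<close> handles \<open>y = - x\<close> (so that the one-dimensional real case
  needs no separate treatment). A modulus \<open>\<delta>\<close> that works at one point \<open>a\<close> then works at
  every point \<open>T a\<close>, because conjugation by an isometry \<open>T\<close> preserves the
  distance to the identity.
\<close>

text \<open>Elements of \<open>'a \<Rightarrow>\<^sub>L 'a\<close> are additive already, and the
  locale supplies the vector space axioms contained in \<open>Vector_Spaces.linear\<close>. Of
  linearity over the field only homogeneity is left to check.\<close>

lemma surjective_isometries_iff:
  assumes "banach_space_over scl"
  shows "T \<in> surjective_isometries scl \<longleftrightarrow>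
    (\<forall>c x. blinfun_apply T (scl c x) = scl c (blinfun_apply T x)) \<and>
    surj (blinfun_apply T) \<and> (\<forall>x. norm (blinfun_apply T x) = norm x)"
proof -
  interpret banach_space_over scl by fact
  have "vector_space scl" by unfold_locales
  then show ?thesis
    by (auto simp: surjective_isometries_def bounded_operators_def Vector_Spaces.linear_iff
        blinfun.add_right)
qed

lemma id_mem_surjective_isometries:
  "banach_space_over scl \<Longrightarrow> id_blinfun \<in> surjective_isometries scl"
  by (simp add: surjective_isometries_iff surj_def)

lemma uminus_id_mem_surjective_isometries:
  assumes "banach_space_over scl"
  shows "- id_blinfun \<in> surjective_isometries scl"
proof -
  interpret banach_space_over scl by fact
  have "\<exists>x. y = - x" for y :: 'b
    by (rule exI[of _ "- y"]) simp
  then show ?thesis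
    by (auto simp: surjective_isometries_iff[OF assms] surj_def blinfun.minus_left)
qed

lemma compose_mem_surjective_isometries:
  assumes "banach_space_over scl" "S \<in> surjective_isometries scl" "T \<in> surjective_isometries scl"
  shows "S o\<^sub>L T \<in> surjective_isometries scl"
proof -
  have "surj (\<lambda>x. blinfun_apply S (blinfun_apply T x))"
    using assms comp_surj[of "blinfun_apply T" "blinfun_apply S"]
    by (auto simp: surjective_isometries_iff comp_def)
  moreover have "blinfun_apply (S o\<^sub>L T) = (\<lambda>x. blinfun_apply S (blinfun_apply T x))"
    by auto
  ultimately show ?thesis
    using assms by (simp add: surjective_isometries_iff)
qed

text \<open>Norm preservation makes \<open>T\<close> injective and passes to the inverse function,
  which is thus bounded with constant 1. Each linearity identity for the inverse follows by applying
  \<open>T\<close> to both sides.\<close>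

lemma inverse_mem_surjective_isometries:
  assumes ban: "banach_space_over scl" and T: "T \<in> surjective_isometries scl"
  obtains T' where "T' \<in> surjective_isometries scl"
    "\<And>x. blinfun_apply T' (blinfun_apply T x) = x"
    "\<And>x. blinfun_apply T (blinfun_apply T' x) = x"
proof -
  note T = T[unfolded surjective_isometries_iff[OF ban]]
  have "inj (blinfun_apply T)"
  proof (rule injI)
    fix x y assume "blinfun_apply T x = blinfun_apply T y"
    then have "norm (blinfun_apply T (x - y)) = 0"
      by (simp add: blinfun.diff_right)
    then show "x = y"
      using T by simp
  qed
  with T have bij: "bij (blinfun_apply T)"
    by (simp add: bij_def)
  define g where "g = inv (blinfun_apply T)"
  have Tg: "blinfun_apply T (g x) = x" and gT: "g (blinfun_apply T x) = x" for x
    using bij by (simp_all add: g_def bij_is_surj surj_f_inv_f bij_is_inj)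
  have norm_g: "norm (g x) = norm x" for x
    using T Tg by metis
  have "bounded_linear g"
  proof (rule bounded_linear_intro[where K = 1])
    show "g (x + y) = g x + g y" for x y
      by (metis Tg gT blinfun.add_right)
    show "g (r *\<^sub>R x) = r *\<^sub>R g x" for r x
      by (metis Tg gT blinfun.scaleR_right)
    show "norm (g x) \<le> norm x * 1" for x
      by (simp add: norm_g)
  qed
  \<comment> \<open>\<open>Blinfun g\<close> acts as \<open>g\<close> only once \<open>g\<close> is
    known to be bounded linear.\<close>
  then have app: "blinfun_apply (Blinfun g) = g"
    by (rule bounded_linear_Blinfun_apply)
  have "g (scl c x) = scl c (g x)" for c x
    using T by (metis Tg gT)
  moreover have "surj g"
    using gT by (metis surj_def)
  ultimately have "Blinfun g \<in> surjective_isometries scl"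
    by (simp add: surjective_isometries_iff[OF ban] app norm_g)
  then show thesis
    using that Tg gT app by metis
qed

lemma connected_in_sphere_through:
  fixes x y :: "'a::real_normed_vector"
  assumes "norm x = 1" "norm y = 1" "y \<noteq> - x"
  obtains C where "connected C" "C \<subseteq> sphere 0 1" "x \<in> C" "y \<in> C"
proof -
  define p where "p t = (1 - t) *\<^sub>R x + t *\<^sub>R y" for t :: real
  \<comment> \<open>The segment must avoid 0 to be normalised continuously. At a zero the two
    summands have equal norm, so 1 - t = t because \<open>x\<close> and \<open>y\<close> are unit
    vectors; the midpoint then gives \<open>x = - y\<close>.\<close>
  have nz: "p t \<noteq> 0" if "t \<in> {0..1}" for t
  proof
    assume "p t = 0"
    then have eq: "(1 - t) *\<^sub>R x = - (t *\<^sub>R y)"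
      by (simp add: p_def eq_neg_iff_add_eq_0)
    have "norm ((1 - t) *\<^sub>R x) = norm (t *\<^sub>R y)"
      unfolding eq by simp
    then have "t = 1 / 2"
      using that assms by simp
    with eq have "(1 / 2) *\<^sub>R x = (1 / 2) *\<^sub>R (- y)"
      by simp
    then have "x = - y"
      by (rule scaleR_left_imp_eq[rotated]) simp
    then show False
      using assms by simp
  qed
  define C where "C = (\<lambda>t. p t /\<^sub>R norm (p t)) ` {0..1}"
  have "continuous_on {0..1} (\<lambda>t. p t /\<^sub>R norm (p t))"
    using nz unfolding p_def by (intro continuous_intros) auto
  then have "connected C"
    unfolding C_def by (rule connected_continuous_image) simp
  moreover have "C \<subseteq> sphere 0 1"
    using nz by (auto simp: C_def)
  moreover have "x \<in> C"
    unfolding C_def by (rule image_eqI[of _ _ 0]) (simp_all add: p_def assms)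
  moreover have "y \<in> C"
    unfolding C_def by (rule image_eqI[of _ _ 1]) (simp_all add: p_def assms)
  ultimately show thesis
    using that by blast
qed

text \<open>Micro-transitivity in metric form at a single point, obtained by taking the
  \<epsilon>-ball around the identity as the neighbourhood. Here \<delta> may still depend on
  \<open>a\<close>.\<close>

lemma micro_transitive_norm_at:
  fixes a :: "'a::banach"
  assumes "banach_space_over scl" "micro_transitive_norm scl" "norm a = 1" "\<epsilon> > 0"
  obtains \<delta> where "\<delta> > 0"
    "\<And>y. \<lbrakk>norm y = 1; norm (a - y) < \<delta>\<rbrakk> \<Longrightarrow>
      \<exists>S \<in> surjective_isometries scl. blinfun_apply S a = y \<and> norm (S - id_blinfun) < \<epsilon>"
proof -
  define U where "U = surjective_isometries scl \<inter> ball id_blinfun \<epsilon>"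
  have "openin (top_of_set (surjective_isometries scl)) U"
    by (simp add: U_def openin_open_Int)
  then have "neighbourhood_in (top_of_set (surjective_isometries scl)) id_blinfun U"
    using id_mem_surjective_isometries[OF assms(1)] assms(4)
    by (auto simp: neighbourhood_in_def U_def intro!: exI[of _ U])
  then have "neighbourhood_in (top_of_set (sphere 0 1)) a ((\<lambda>T. blinfun_apply T a) ` U)"
    using assms(2,3) by (simp add: micro_transitive_norm_def)
  then obtain V where "openin (top_of_set (sphere 0 1)) V" "a \<in> V"
    and V: "V \<subseteq> (\<lambda>T. blinfun_apply T a) ` U"
    by (auto simp: neighbourhood_in_def)
  then obtain \<delta> where \<delta>: "\<delta> > 0" "ball a \<delta> \<inter> sphere 0 1 \<subseteq> V"
    by (auto simp: openin_contains_ball)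
  show thesis
  proof (rule that[OF \<delta>(1)])
    fix y :: 'a assume "norm y = 1" "norm (a - y) < \<delta>"
    then have "y \<in> V"
      using \<delta>(2) by (auto simp: dist_norm)
    then show "\<exists>S \<in> surjective_isometries scl. blinfun_apply S a = y \<and> norm (S - id_blinfun) < \<epsilon>"
      using V by (fastforce simp: U_def dist_norm norm_minus_commute)
  qed
qed

lemma micro_transitive_norm_imp_transitive:
  fixes x y :: "'a::banach"
  assumes ban: "banach_space_over scl" and mt: "micro_transitive_norm scl"
    and x: "norm x = 1" and y: "norm y = 1"
  obtains T where "T \<in> surjective_isometries scl" "blinfun_apply T x = y"
proof (cases "y = - x")
  case True
  then show thesis
    using that uminus_id_mem_surjective_isometries[OF ban] by (simp add: blinfun.minus_left)
next
  case False
  \<comment> \<open>\<open>R\<close> says that two points lie in one orbit. An equivalence relation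
    whose classes are relatively open in a connected set has only one class there.\<close>
  define R where "R a b \<longleftrightarrow> (\<exists>T \<in> surjective_isometries scl. blinfun_apply T a = b)" for a b
  obtain C where C: "connected C" "C \<subseteq> sphere 0 1" "x \<in> C" "y \<in> C"
    using connected_in_sphere_through[OF x y False] .
  have "R x y"
  proof (rule connected_equivalence_relation[OF C(1,3,4)])
    show "R b a" if "R a b" for a b
      using that inverse_mem_surjective_isometries[OF ban] unfolding R_def by metis
    show "R a c" if "R a b" "R b c" for a b c
      using that compose_mem_surjective_isometries[OF ban] unfolding R_def
      by (metis blinfun_apply_blinfun_compose)
    show "\<exists>W. openin (top_of_set C) W \<and> a \<in> W \<and> (\<forall>b \<in> W. R a b)" if "a \<in> C" for a
    proof -
      have "norm a = 1"
        using that C(2) by auto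
      then obtain \<delta> where \<delta>: "\<delta> > 0"
        "\<And>b. \<lbrakk>norm b = 1; norm (a - b) < \<delta>\<rbrakk> \<Longrightarrow>
          \<exists>S \<in> surjective_isometries scl. blinfun_apply S a = b \<and> norm (S - id_blinfun) < 1"
        \<comment> \<open>The radius 1 is arbitrary: openness of the orbit uses only that
          \<open>S\<close> exists, not its distance to the identity.\<close>
        using micro_transitive_norm_at[OF ban mt, of a 1] by auto
      have "R a b" if "b \<in> C \<inter> ball a \<delta>" for b
      proof -
        have "norm b = 1" "norm (a - b) < \<delta>"
          using that C(2) by (auto simp: dist_norm)
        then show ?thesis
          using \<delta>(2) by (auto simp: R_def)
      qed
      then show ?thesis
        using \<open>a \<in> C\<close> \<delta>(1) by (intro exI[of _ "C \<inter> ball a \<delta>"]) (auto intro: openin_open_Int)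
    qed
  qed
  then show thesis
    using that by (auto simp: R_def)
qed

text \<open>Since \<open>T o\<^sub>L T'\<close> is the identity, the difference on the left factors
  as \<open>T o\<^sub>L (S - id_blinfun) o\<^sub>L T'\<close>, and the outer factors preserve
  norms.\<close>

lemma norm_conjugate_isometry_le:
  fixes S T T' :: "'a::real_normed_vector \<Rightarrow>\<^sub>L 'a"
  assumes T: "\<And>x. norm (blinfun_apply T x) = norm x"
    and T': "\<And>x. norm (blinfun_apply T' x) = norm x"
    and inv: "\<And>x. blinfun_apply T (blinfun_apply T' x) = x"
  shows "norm ((T o\<^sub>L S o\<^sub>L T') - id_blinfun) \<le> norm (S - id_blinfun)"
proof (rule norm_blinfun_bound)
  fix x
  have "blinfun_apply ((T o\<^sub>L S o\<^sub>L T') - id_blinfun) x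
      = blinfun_apply T (blinfun_apply (S - id_blinfun) (blinfun_apply T' x))"
    by (simp add: blinfun.diff_left blinfun.diff_right inv)
  then show "norm (blinfun_apply ((T o\<^sub>L S o\<^sub>L T') - id_blinfun) x) \<le> norm (S - id_blinfun) * norm x"
    using norm_blinfun[of "S - id_blinfun" "blinfun_apply T' x"] by (simp add: T T')
qed simp

lemma micro_transitive_norm_uniform:
  fixes scl :: "'k::real_normed_field \<Rightarrow> 'a::banach \<Rightarrow> 'a"
  assumes ban: "banach_space_over scl" and mt: "micro_transitive_norm scl" and "\<epsilon> > 0"
  shows "\<exists>\<delta>>0. \<forall>x \<in> sphere 0 1. \<forall>y \<in> sphere 0 1. norm (x - y) < \<delta> \<longrightarrow>
    (\<exists>T \<in> surjective_isometries scl. blinfun_apply T x = y \<and> norm (T - id_blinfun) < \<epsilon>)"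
proof (cases "sphere (0::'a) 1 = {}")
  \<comment> \<open>In the zero space there is no base point, and the claim is vacuous for any
    \<delta>.\<close>
  case True
  then show ?thesis
    by (auto intro!: exI[of _ 1])
next
  case False
  then obtain a :: 'a where a: "norm a = 1"
    by auto
  obtain \<delta> where \<delta>: "\<delta> > 0"
    "\<And>y. \<lbrakk>norm y = 1; norm (a - y) < \<delta>\<rbrakk> \<Longrightarrow>
      \<exists>S \<in> surjective_isometries scl. blinfun_apply S a = y \<and> norm (S - id_blinfun) < \<epsilon>"
    using micro_transitive_norm_at[OF ban mt a \<open>\<epsilon> > 0\<close>] by blast
  have "\<exists>T \<in> surjective_isometries scl. blinfun_apply T x = y \<and> norm (T - id_blinfun) < \<epsilon>"
    if x: "norm x = 1" and y: "norm y = 1" and xy: "norm (x - y) < \<delta>" for x y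
  proof -
    obtain T where T: "T \<in> surjective_isometries scl" "blinfun_apply T a = x"
      using micro_transitive_norm_imp_transitive[OF ban mt a x] .
    obtain T' where T': "T' \<in> surjective_isometries scl"
      "\<And>z. blinfun_apply T' (blinfun_apply T z) = z"
      "\<And>z. blinfun_apply T (blinfun_apply T' z) = z"
      using inverse_mem_surjective_isometries[OF ban T(1)] by metis
    have norm_T: "norm (blinfun_apply T z) = norm z"
      and norm_T': "norm (blinfun_apply T' z) = norm z" for z
      using T(1) T'(1) by (simp_all add: surjective_isometries_iff[OF ban])
    have T'x: "blinfun_apply T' x = a"
      using T(2) T'(2) by metis
    \<comment> \<open>The isometry \<open>T'\<close> carries the pair \<open>x\<close>,
      \<open>y\<close> back to \<open>a\<close>, \<open>T' y\<close> at the same distance, so the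
      modulus at \<open>a\<close> applies.\<close>
    have "norm (a - blinfun_apply T' y) < \<delta>"
      using xy norm_T'[of "x - y"] by (simp add: blinfun.diff_right T'x)
    then obtain S where S: "S \<in> surjective_isometries scl"
      "blinfun_apply S a = blinfun_apply T' y" "norm (S - id_blinfun) < \<epsilon>"
      using \<delta>(2)[of "blinfun_apply T' y"] norm_T' y by auto
    show ?thesis
    proof (intro bexI conjI)
      \<comment> \<open>The conjugate moves \<open>x\<close> to \<open>a\<close>, then to
        \<open>T' y\<close>, then to \<open>y\<close>.\<close>
      show "T o\<^sub>L S o\<^sub>L T' \<in> surjective_isometries scl"
        by (intro compose_mem_surjective_isometries ban T(1) S(1) T'(1))
      show "blinfun_apply (T o\<^sub>L S o\<^sub>L T') x = y"
        by (simp add: T'x S(2) T'(3))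
      show "norm ((T o\<^sub>L S o\<^sub>L T') - id_blinfun) < \<epsilon>"
        using norm_conjugate_isometry_le[OF norm_T norm_T' T'(3), of S] S(3) by linarith
    qed
  qed
  with \<delta>(1) show ?thesis
    by auto
qed

theorem proposition2p1:
  fixes scl :: "'k::real_normed_field \<Rightarrow> 'a::banach \<Rightarrow> 'a"
  assumes "banach_space_over scl"
    and "micro_transitive_norm scl"
  shows "\<exists>\<beta> \<in> {0<..<2} \<rightarrow> {0<..}.
    \<forall>\<epsilon>::real \<in> {0<..<2}. \<forall>x \<in> sphere 0 1. \<forall>y \<in> sphere 0 1. norm (x - y) < (\<beta> \<epsilon> :: real) \<longrightarrow>
      (\<exists>T \<in> surjective_isometries scl.
         blinfun_apply T x = y \<and> norm (T - id_blinfun) < \<epsilon>)"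
proof -
  \<comment> \<open>As \<delta> depends on \<epsilon> alone, choosing one for each positive
    \<epsilon> defines the function \<beta>.\<close>
  obtain \<beta> :: "real \<Rightarrow> real" where \<beta>: "\<And>\<epsilon>. \<epsilon> > 0 \<Longrightarrow> \<beta> \<epsilon> > 0 \<and>
      (\<forall>x \<in> sphere 0 1. \<forall>y \<in> sphere 0 1. norm (x - y) < \<beta> \<epsilon> \<longrightarrow>
        (\<exists>T \<in> surjective_isometries scl. blinfun_apply T x = y \<and> norm (T - id_blinfun) < \<epsilon>))"
    using micro_transitive_norm_uniform[OF assms] by metis
  show ?thesis
  proof (intro bexI ballI)
    show "\<beta> \<in> {0<..<2} \<rightarrow> {0<..}"
      using \<beta> by auto
  qed (use \<beta> in auto)
qed

end
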